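(* A permutation $\pi\in B_n$ is a $B$-arc permutation if and only if it avoids the following $24$ patterns (each $\pm$ ranging over both signs): $$[\pm2,1,3],[\pm2,3,1],[\pm3,1,-2],[\pm3,-2,1],[\pm1,2,-3],[\pm1,-3,2],$$ $$[\pm2,-1,-3],[\pm2,-3,-1],[\pm3,-1,2],[\pm3,2,-1],[\pm1,-2,3],[\pm1,3,-2].$$
   Context: $B_n$ is the group of bijections $\pi$ of $\{\pm1,\dots,\pm n\}$ with $\pi(-a)=-\pi(a)$, written $\pi=[\pi(1),\dots,\pi(n)]$. Let $\mathcal{O}_n$ be a circle with $2n$ points labeled $-1,-2,\dots,-n,1,2,\dots,n$ in clockwise order (equivalently, identify $j$ with $j\in\mathbb{Z}_{2n}$ and $-j$ with $n+j\in\mathbb{Z}_{2n}$); an interval in $\mathcal{O}_n$ is a set of cyclically consecutive points. $\pi\in B_n$ is a $B$-arc permutation if for every $1\le j\le n$ the set $\{\pi(j),\dots,\pi(n)\}$ is an interval in $\mathcal{O}_n$. Pattern containment: $\pi\in B_n$ contains $\sigma\in B_k$ if there are indices $i_1<\dots<i_k$ such that $\pi(i_j)$ and $\sigma(j)$ have the same sign for all $j$ and $|\pi(i_1)|\cdots|\pi(i_k)|$ is in the same relative order as $|\sigma(1)|\cdots|\sigma(k)|$; otherwise $\pi$ avoids $\sigma$. *)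

theory Defs
  imports "HOL-Combinatorics.Permutations"
begin

definition signed_points :: "nat \<Rightarrow> int set" where
  "signed_points n = {a. a \<noteq> 0 \<and> \<bar>a\<bar> \<le> int n}"

text \<open>
  A signed permutation is a total function on the integers; \<open>permutes\<close> makes it the
  identity outside \<open>{\<plusminus>1, \<dots>, \<plusminus>n}\<close>, so each element of \<open>B\<^sub>n\<close> has exactly one representative.
\<close>

definition signed_perms :: "nat \<Rightarrow> (int \<Rightarrow> int) set" where
  "signed_perms n =
     {\<pi>. \<pi> permutes signed_points n \<and> (\<forall>a \<in> signed_points n. \<pi> (- a) = - \<pi> a)}"

text \<open>The element \<open>\<pi> = [\<pi>(1), \<dots>, \<pi>(k)]\<close> of \<open>B\<^sub>k\<close> given by its one-line notation.\<close>

definition of_window :: "int list \<Rightarrow> int \<Rightarrow> int" where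
  "of_window ws a =
     (if a \<in> signed_points (length ws) then sgn a * ws ! (nat \<bar>a\<bar> - 1) else a)"

text \<open>
  The position of a point on the circle \<open>\<O>\<^sub>n\<close> as a residue modulo \<open>2n\<close> in \<open>{0..<2n}\<close>:
  \<open>j\<close> sits at \<open>j\<close> and \<open>-j\<close> at \<open>n + j\<close> for \<open>1 \<le> j \<le> n\<close>; in particular \<open>-n\<close> sits at \<open>0\<close>.
\<close>

definition circle_pos :: "nat \<Rightarrow> int \<Rightarrow> int" where
  "circle_pos n a = (if a > 0 then a else int n + \<bar>a\<bar>) mod (2 * int n)"

definition circle_interval :: "nat \<Rightarrow> int set \<Rightarrow> bool" where
  "circle_interval n A \<longleftrightarrow>
     A \<subseteq> signed_points n \<and>
     (\<exists>(s::int) (l::nat). circle_pos n ` A = (\<lambda>i. (s + int i) mod (2 * int n)) ` {..<l})"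

definition B_arc :: "nat \<Rightarrow> (int \<Rightarrow> int) \<Rightarrow> bool" where
  "B_arc n \<pi> \<longleftrightarrow>
     \<pi> \<in> signed_perms n \<and> (\<forall>j \<in> {1..int n}. circle_interval n (\<pi> ` {j..int n}))"

text \<open>\<open>\<pi> \<in> B\<^sub>n\<close> contains \<open>\<sigma> \<in> B\<^sub>k\<close>; \<open>f\<close> lists the indices \<open>i\<^sub>1 < \<dots> < i\<^sub>k\<close>.\<close>

definition contains_pattern :: "nat \<Rightarrow> (int \<Rightarrow> int) \<Rightarrow> nat \<Rightarrow> (int \<Rightarrow> int) \<Rightarrow> bool" where
  "contains_pattern n \<pi> k \<sigma> \<longleftrightarrow>
     (\<exists>f :: int \<Rightarrow> int.
        f ` {1..int k} \<subseteq> {1..int n} \<and> strict_mono_on {1..int k} f \<and>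
        (\<forall>j \<in> {1..int k}. sgn (\<pi> (f j)) = sgn (\<sigma> j)) \<and>
        (\<forall>i \<in> {1..int k}. \<forall>j \<in> {1..int k}.
           \<bar>\<pi> (f i)\<bar> < \<bar>\<pi> (f j)\<bar> \<longleftrightarrow> \<bar>\<sigma> i\<bar> < \<bar>\<sigma> j\<bar>))"

abbreviation avoids_pattern :: "nat \<Rightarrow> (int \<Rightarrow> int) \<Rightarrow> nat \<Rightarrow> (int \<Rightarrow> int) \<Rightarrow> bool" where
  "avoids_pattern n \<pi> k \<sigma> \<equiv> \<not> contains_pattern n \<pi> k \<sigma>"

text \<open>The sign \<open>e\<close> is the \<open>\<plusminus>\<close> of the first entry.\<close>

definition B_arc_windows :: "int list set" where
  "B_arc_windows =
     (\<Union>e \<in> {1, -1}.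
       {[e * 2, 1, 3], [e * 2, 3, 1], [e * 3, 1, -2], [e * 3, -2, 1], [e * 1, 2, -3], [e * 1, -3, 2],
        [e * 2, -1, -3], [e * 2, -3, -1], [e * 3, -1, 2], [e * 3, 2, -1], [e * 1, -2, 3], [e * 1, 3, -2]})"

lemma card_B_arc_windows: "card B_arc_windows = 24"
  by (simp add: B_arc_windows_def)

lemma signed_points_3: "signed_points 3 = {1, 2, 3, -1, -2, -3}"
  by (auto simp: signed_points_def)

lemma of_window_image_3:
  "of_window [a, b, c] ` signed_points 3 = {a, b, c, - a, - b, - c}"
proof -
  have "signed_points (length [a, b, c]) = {1, 2, 3, -1, -2, -3}"
    by (simp add: signed_points_3 flip: numeral_3_eq_3)
  then show ?thesis
    unfolding signed_points_3 image_insert image_empty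
    by (simp add: of_window_def numeral_2_eq_2 insert_commute)
qed

lemma of_window_in_signed_perms:
  assumes "ws \<in> B_arc_windows"
  shows "of_window ws \<in> signed_perms 3"
proof -
  have len: "length ws = 3"
    using assms by (auto simp: B_arc_windows_def)
  have im: "of_window ws ` signed_points 3 = signed_points 3"
  proof -
    have "\<forall>ws \<in> B_arc_windows. \<exists>a b c.
        ws = [a, b, c] \<and> {a, b, c, - a, - b, - c} = {1, 2, 3, -1, -2, -3}"
      unfolding B_arc_windows_def by (simp; intro conjI; auto)
    with assms obtain a b c where "ws = [a, b, c]" "{a, b, c, - a, - b, - c} = signed_points 3"
      unfolding signed_points_3 by blast
    then show ?thesis
      by (simp only: of_window_image_3)
  qed
  have fin: "finite (signed_points 3)"
    by (simp add: signed_points_3)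
  have "inj_on (of_window ws) (signed_points 3)"
    by (rule eq_card_imp_inj_on) (simp_all add: fin im)
  then have "of_window ws permutes signed_points 3"
    by (intro bij_imp_permutes) (use im in \<open>auto simp: bij_betw_def\<close>, simp add: of_window_def len)
  moreover have "of_window ws (- a) = - of_window ws a" if "a \<in> signed_points 3" for a
    using that len by (auto simp: of_window_def signed_points_def)
  ultimately show ?thesis
    by (simp add: signed_perms_def)
qed

end

theory Submission
  imports Defs
begin

text \<open>
  A suffix \<open>\<pi> ` {j..n}\<close> never contains a point together with its antipode, so if it is an interval
  it contains the shorter of the two arcs between any two of its points. Hence for \<open>i < j < k\<close>
  neither \<open>\<pi> i\<close> nor \<open>- \<pi> i\<close> lies strictly inside the shorter arc from \<open>\<pi> j\<close> to \<open>\<pi> k\<close>, and the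
  24 patterns are exactly the relative positions violating this. Conversely, the
  suffixes are shown to be intervals by adding one point at a time: if \<open>\<pi> j\<close> is not adjacent to the
  interval \<open>I\<close> already built, then the point next to \<open>I\<close> on the shorter arc from \<open>I\<close> to \<open>\<pi> j\<close> is, up
  to sign, some \<open>\<pi> i\<close> with \<open>i < j\<close>.

  Points of the circle are handled through integer lifts of \<open>circle_pos\<close> modulo \<open>2n\<close>. Reducing
  further modulo \<open>n\<close> identifies antipodes, which accounts for the free sign of the first entry.
\<close>

text \<open>\<open>x\<close> or \<open>- x\<close> lies strictly inside the shorter arc from \<open>y\<close> to \<open>z\<close>
  (see \<open>separates_iff_between\<close>); the size of the circle does not enter.\<close>

definition separates :: "int \<Rightarrow> int \<Rightarrow> int \<Rightarrow> bool" where
  "separates x y z \<longleftrightarrow>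
     (if sgn y = sgn z then \<bar>y\<bar> < \<bar>x\<bar> \<and> \<bar>x\<bar> < \<bar>z\<bar> \<or> \<bar>z\<bar> < \<bar>x\<bar> \<and> \<bar>x\<bar> < \<bar>y\<bar>
      else \<bar>y\<bar> \<noteq> \<bar>z\<bar> \<and> (\<bar>x\<bar> < \<bar>y\<bar> \<and> \<bar>x\<bar> < \<bar>z\<bar> \<or> \<bar>y\<bar> < \<bar>x\<bar> \<and> \<bar>z\<bar> < \<bar>x\<bar>))"

lemma separates_commute: "separates x y z \<longleftrightarrow> separates x z y"
  by (auto simp: separates_def)

lemma separates_cong_abs: "\<bar>x\<bar> = \<bar>x'\<bar> \<Longrightarrow> separates x y z \<longleftrightarrow> separates x' y z"
  by (simp add: separates_def)

section \<open>Patterns of length three\<close>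

text \<open>The matching condition of \<open>contains_pattern\<close> with the choice of indices
  stripped off, so that it can be decided for three given values.\<close>

definition same_pattern :: "int list \<Rightarrow> int list \<Rightarrow> bool" where
  "same_pattern vs ws \<longleftrightarrow> map sgn vs = map sgn ws \<and>
     (\<forall>i < length ws. \<forall>j < length ws. \<bar>vs ! i\<bar> < \<bar>vs ! j\<bar> \<longleftrightarrow> \<bar>ws ! i\<bar> < \<bar>ws ! j\<bar>)"

lemma same_pattern_3:
  "same_pattern [x, y, z] [a, b, c] \<longleftrightarrow>
     sgn x = sgn a \<and> sgn y = sgn b \<and> sgn z = sgn c \<and>
     (\<bar>x\<bar> < \<bar>y\<bar> \<longleftrightarrow> \<bar>a\<bar> < \<bar>b\<bar>) \<and> (\<bar>y\<bar> < \<bar>x\<bar> \<longleftrightarrow> \<bar>b\<bar> < \<bar>a\<bar>) \<and>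
     (\<bar>x\<bar> < \<bar>z\<bar> \<longleftrightarrow> \<bar>a\<bar> < \<bar>c\<bar>) \<and> (\<bar>z\<bar> < \<bar>x\<bar> \<longleftrightarrow> \<bar>c\<bar> < \<bar>a\<bar>) \<and>
     (\<bar>y\<bar> < \<bar>z\<bar> \<longleftrightarrow> \<bar>b\<bar> < \<bar>c\<bar>) \<and> (\<bar>z\<bar> < \<bar>y\<bar> \<longleftrightarrow> \<bar>c\<bar> < \<bar>b\<bar>)"
  by (auto simp: same_pattern_def All_less_Suc numeral_3_eq_3)

text \<open>If the last two entries of a window have equal signs, its first entry is \<plusminus>2,
  the middle absolute value; if their signs differ, it is \<plusminus>1 or \<plusminus>3, an extreme
  one. All windows of these shapes are listed. Both branches of \<open>separates\<close> force three
  distinct absolute values, as a match with a window does.\<close>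

lemma same_pattern_B_arc_windows:
  assumes "x \<noteq> 0" "y \<noteq> 0" "z \<noteq> 0"
  shows "(\<exists>ws \<in> B_arc_windows. same_pattern [x, y, z] ws) \<longleftrightarrow> separates x y z"
proof -
  have sgn: "sgn w = 1 \<or> sgn w = -1" if "w \<noteq> 0" for w :: int
    using that by (auto simp: sgn_if)
  show ?thesis
    using sgn[OF assms(1)] sgn[OF assms(2)] sgn[OF assms(3)]
    by (elim disjE; simp add: B_arc_windows_def same_pattern_3 separates_def; smt (verit))
qed

lemma atLeastAtMost_1_3: "{1..3::int} = {1, 2, 3}"
  by auto

lemma of_window_3:
  "of_window [a, b, c] 1 = a" "of_window [a, b, c] 2 = b" "of_window [a, b, c] 3 = c"
  by (simp_all add: of_window_def signed_points_def numeral_2_eq_2)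

lemma contains_pattern_of_window_3:
  "contains_pattern n \<pi> 3 (of_window [a, b, c]) \<longleftrightarrow>
     (\<exists>i j k. 1 \<le> i \<and> i < j \<and> j < k \<and> k \<le> int n \<and> same_pattern [\<pi> i, \<pi> j, \<pi> k] [a, b, c])"
  (is "?L \<longleftrightarrow> ?R")
proof
  assume ?L
  then obtain f where "f ` {1..3} \<subseteq> {1..int n}" "strict_mono_on {1..3} f"
    "\<forall>j \<in> {1..3}. sgn (\<pi> (f j)) = sgn (of_window [a, b, c] j)"
    "\<forall>i \<in> {1..3}. \<forall>j \<in> {1..3}. \<bar>\<pi> (f i)\<bar> < \<bar>\<pi> (f j)\<bar> \<longleftrightarrow>
       \<bar>of_window [a, b, c] i\<bar> < \<bar>of_window [a, b, c] j\<bar>"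
    by (auto simp: contains_pattern_def)
  then have "1 \<le> f 1 \<and> f 1 < f 2 \<and> f 2 < f 3 \<and> f 3 \<le> int n \<and>
      same_pattern [\<pi> (f 1), \<pi> (f 2), \<pi> (f 3)] [a, b, c]"
    by (simp add: atLeastAtMost_1_3 of_window_3 same_pattern_3 strict_mono_on_def)
  then show ?R by blast
next
  assume ?R
  then obtain i j k where ijk: "1 \<le> i" "i < j" "j < k" "k \<le> int n"
    and pat: "same_pattern [\<pi> i, \<pi> j, \<pi> k] [a, b, c]"
    by blast
  \<comment> \<open>Only the values at 1, 2, 3 are inspected; \<open>k\<close> elsewhere is a
    default.\<close>
  define f :: "int \<Rightarrow> int" where "f m = (if m = 1 then i else if m = 2 then j else k)" for m
  show ?L
    unfolding contains_pattern_def
    using ijk pat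
    by (intro exI[of _ f])
      (simp add: f_def atLeastAtMost_1_3 of_window_3 same_pattern_3 strict_mono_on_def; presburger)
qed

text \<open>Trades the 24 patterns for the single relation \<open>separates\<close>; from here on no
  window is mentioned until the final theorem.\<close>

lemma contains_B_arc_window_iff:
  assumes nz: "\<And>i. i \<in> {1..int n} \<Longrightarrow> \<pi> i \<noteq> 0"
  shows "(\<exists>ws \<in> B_arc_windows. contains_pattern n \<pi> 3 (of_window ws)) \<longleftrightarrow>
    (\<exists>i j k. 1 \<le> i \<and> i < j \<and> j < k \<and> k \<le> int n \<and> separates (\<pi> i) (\<pi> j) (\<pi> k))"
proof -
  have "contains_pattern n \<pi> 3 (of_window ws) \<longleftrightarrow>
      (\<exists>i j k. 1 \<le> i \<and> i < j \<and> j < k \<and> k \<le> int n \<and> same_pattern [\<pi> i, \<pi> j, \<pi> k] ws)"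
    if "ws \<in> B_arc_windows" for ws
  proof -
    have "\<exists>a b c. ws = [a, b, c]"
      using that by (auto simp: B_arc_windows_def)
    then show ?thesis
      using contains_pattern_of_window_3 by blast
  qed
  then have "(\<exists>ws \<in> B_arc_windows. contains_pattern n \<pi> 3 (of_window ws)) \<longleftrightarrow>
      (\<exists>i j k. 1 \<le> i \<and> i < j \<and> j < k \<and> k \<le> int n \<and>
        (\<exists>ws \<in> B_arc_windows. same_pattern [\<pi> i, \<pi> j, \<pi> k] ws))"
    by blast
  also have "\<dots> \<longleftrightarrow> (\<exists>i j k. 1 \<le> i \<and> i < j \<and> j < k \<and> k \<le> int n \<and> separates (\<pi> i) (\<pi> j) (\<pi> k))"
    by (intro ex_cong1 conj_cong refl same_pattern_B_arc_windows nz) auto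
  finally show ?thesis .
qed

section \<open>Points of the circle as residues modulo 2n\<close>

lemma signed_points_cases:
  assumes "a \<in> signed_points n"
  obtains "a > 0" "a \<le> int n" "n > 0" | "a < 0" "- a \<le> int n" "n > 0"
  using assms that by (cases "a > 0") (auto simp: signed_points_def)

lemma circle_pos_mod [simp]: "circle_pos n a mod (2 * int n) = circle_pos n a"
  by (simp add: circle_pos_def)

lemma circle_pos_surj:
  assumes "n > 0"
  obtains a where "a \<in> signed_points n" "circle_pos n a = u mod (2 * int n)"
proof -
  define r where "r = u mod (2 * int n)"
  have r: "0 \<le> r" "r < 2 * int n"
    using assms by (simp_all add: r_def)
  \<comment> \<open>The inverse of \<open>circle_pos\<close>: residue 0 belongs to -n, residues 1 to
    n to themselves, and a residue r > n to n - r.\<close>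
  consider "r = 0" | "0 < r" "r \<le> int n" | "int n < r" using r by linarith
  then show ?thesis
  proof cases
    case 1
    then show ?thesis
      using assms r_def by (intro that[of "- int n"]) (auto simp: signed_points_def circle_pos_def)
  next
    case 2
    then show ?thesis
      using assms r r_def by (intro that[of r]) (auto simp: signed_points_def circle_pos_def)
  next
    case 3
    then show ?thesis
      using assms r r_def by (intro that[of "int n - r"]) (auto simp: signed_points_def circle_pos_def)
  qed
qed

lemma circle_pos_uminus:
  assumes "a \<in> signed_points n"
  shows "circle_pos n (- a) = (circle_pos n a + int n) mod (2 * int n)"
  using assms
proof (cases rule: signed_points_cases)
  case 1
  then show ?thesis by (simp add: circle_pos_def mod_simps add.commute)
next
  case 2
  \<comment> \<open>For negative \<open>a\<close> the half turn passes the origin, so a full turn 2n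
    has to be dropped.\<close>
  have "(int n - a + int n) mod (2 * int n) = (- a + 2 * int n) mod (2 * int n)"
    by (simp add: algebra_simps)
  with 2 show ?thesis by (simp add: circle_pos_def mod_simps)
qed

lemma circle_pos_mod_n: "circle_pos n a mod int n = \<bar>a\<bar> mod int n"
  by (simp add: circle_pos_def mod_mod_cancel)

text \<open>Absolute values of points lie in 1..n, a complete residue system modulo n. With
  \<open>circle_pos_mod_n\<close>, a position modulo n thus determines the point up to sign.\<close>

lemma abs_eq_if_mod_eq:
  assumes "a \<in> signed_points n" "b \<in> signed_points n" "\<bar>a\<bar> mod int n = \<bar>b\<bar> mod int n"
  shows "\<bar>a\<bar> = \<bar>b\<bar>"
proof -
  have "int n dvd \<bar>a\<bar> - \<bar>b\<bar>"
    using assms(3) by (simp add: mod_eq_dvd_iff)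
  moreover have "\<bar>\<bar>a\<bar> - \<bar>b\<bar>\<bar> < int n"
    using assms(1,2) by (auto simp: signed_points_def)
  ultimately show ?thesis
    using dvd_imp_le_int[of "\<bar>a\<bar> - \<bar>b\<bar>" "int n"] by fastforce
qed

lemma inj_on_circle_pos: "inj_on (circle_pos n) (signed_points n)"
proof (rule inj_onI)
  fix a b assume ab: "a \<in> signed_points n" "b \<in> signed_points n" "circle_pos n a = circle_pos n b"
  have "\<bar>a\<bar> = \<bar>b\<bar>"
    using abs_eq_if_mod_eq[OF ab(1,2)] ab(3) circle_pos_mod_n by metis
  moreover have "a \<noteq> - b"
  proof
    assume "a = - b"
    then have "(circle_pos n b + int n) mod (2 * int n) = circle_pos n b mod (2 * int n)"
      using ab circle_pos_uminus[OF ab(2)] by simp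
    then have "2 * int n dvd int n"
      by (simp only: mod_eq_dvd_iff) simp
    then show False
      using ab(1) zdvd_imp_le[of "2 * int n" "int n"] by (auto simp: signed_points_def)
  qed
  ultimately show "a = b" by (simp add: abs_eq_iff)
qed

lemma circle_pos_inject:
  "a \<in> signed_points n \<Longrightarrow> b \<in> signed_points n \<Longrightarrow> circle_pos n a = circle_pos n b \<longleftrightarrow> a = b"
  using inj_on_circle_pos by (rule inj_on_eq_iff)

lemma uminus_signed_points: "a \<in> signed_points n \<Longrightarrow> - a \<in> signed_points n"
  by (simp add: signed_points_def)

lemma circle_pos_lift:
  assumes "circle_pos n a = u mod (2 * int n)"
  obtains k where "u = (if a > 0 then a else int n + \<bar>a\<bar>) + 2 * int n * k"
proof -
  have "2 * int n dvd u - (if a > 0 then a else int n + \<bar>a\<bar>)"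
    using assms by (metis circle_pos_def mod_eq_dvd_iff)
  then show ?thesis
    by (metis that dvdE diff_eq_eq add.commute)
qed

section \<open>The shorter arc in terms of integer lifts\<close>

text \<open>Since 0 < v - u < n, the lifts between \<open>u\<close> and \<open>v\<close> run through
  the shorter arc, and the congruence modulo n accepts a lift of \<open>x\<close> or of
  \<open>- x\<close>. After removing common full turns, finitely many linear cases remain.\<close>

lemma separates_iff_between:
  assumes x: "x \<in> signed_points n" and y: "y \<in> signed_points n" and z: "z \<in> signed_points n"
    and u: "circle_pos n y = u mod (2 * int n)" and v: "circle_pos n z = v mod (2 * int n)"
    and uv: "u < v" "v < u + int n"
  shows "separates x y z \<longleftrightarrow> (\<exists>w. u < w \<and> w < v \<and> w mod int n = \<bar>x\<bar> mod int n)"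
proof -
  define L where "L a = (if a > 0 then a else int n + \<bar>a\<bar>)" for a
  have n: "n > 0" using x by (auto simp: signed_points_def)
  obtain k where k: "u = L y + 2 * int n * k" using circle_pos_lift[OF u] unfolding L_def by blast
  obtain m where m: "v = L z + 2 * int n * m" using circle_pos_lift[OF v] unfolding L_def by blast
  have L: "1 \<le> L a" "L a \<le> 2 * int n" if "a \<in> signed_points n" for a
    using that by (auto simp: L_def signed_points_def)
  \<comment> \<open>As \<open>L y\<close> and \<open>L z\<close> lie in 1..2n and 0 < v - u < n, the
    arc crosses the origin of the lifts at most once.\<close>
  have "2 * int n * (m - k) < 2 * int n * 2" "2 * int n * (m - k) > 2 * int n * (- 1)"
    using k m uv L[OF y] L[OF z] n by (auto simp: algebra_simps)
  moreover have "0 < 2 * int n" using n by simp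
  ultimately have "m - k < 2" "m - k > - 1"
    using mult_less_cancel_left_pos by blast+
  then have mk: "m = k \<or> m = k + 1" by linarith
  have "(\<exists>w. u < w \<and> w < v \<and> w mod int n = \<bar>x\<bar> mod int n) \<longleftrightarrow>
      (\<exists>t. u < \<bar>x\<bar> + int n * t \<and> \<bar>x\<bar> + int n * t < v)"
    by (metis mod_mult_self2 mod_eqE add.commute)
  \<comment> \<open>Shifting by 2nk puts the lower end at \<open>L y\<close> \<ge> 1 and the upper
    end at most at 4n; as 1 \<le> \<bar>x\<bar> \<le> n, only four values of \<open>t\<close>
    survive.\<close>
  also have "\<dots> \<longleftrightarrow> (\<exists>t \<in> {0, 1, 2, 3}. L y < \<bar>x\<bar> + int n * t \<and> \<bar>x\<bar> + int n * t < v - 2 * int n * k)"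
  proof (intro iffI; elim exE bexE conjE)
    fix t assume t: "u < \<bar>x\<bar> + int n * t" "\<bar>x\<bar> + int n * t < v"
    have "int n * (t - 2 * k) < int n * 4" "int n * (t - 2 * k) > int n * (- 1)"
      using k m mk t L[OF y] L[OF z] x by (auto simp: signed_points_def algebra_simps)
    moreover have "0 < int n" using n by simp
    ultimately have "t - 2 * k < 4" "t - 2 * k > - 1"
      using mult_less_cancel_left_pos by blast+
    then have "t - 2 * k \<in> {0, 1, 2, 3}" by auto
    moreover have "L y < \<bar>x\<bar> + int n * (t - 2 * k)" "\<bar>x\<bar> + int n * (t - 2 * k) < v - 2 * int n * k"
      using t k by (simp_all add: algebra_simps)
    ultimately show "\<exists>t \<in> {0, 1, 2, 3}. L y < \<bar>x\<bar> + int n * t \<and> \<bar>x\<bar> + int n * t < v - 2 * int n * k"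
      by blast
  next
    fix t :: int assume "L y < \<bar>x\<bar> + int n * t" "\<bar>x\<bar> + int n * t < v - 2 * int n * k"
    then have "u < \<bar>x\<bar> + int n * (t + 2 * k) \<and> \<bar>x\<bar> + int n * (t + 2 * k) < v"
      using k by (simp add: algebra_simps)
    then show "\<exists>t. u < \<bar>x\<bar> + int n * t \<and> \<bar>x\<bar> + int n * t < v" by blast
  qed
  also have "\<dots> \<longleftrightarrow> separates x y z"
  proof -
    have bounds: "L y < v - 2 * int n * k" "v - 2 * int n * k < L y + int n"
      using uv k by simp_all
    have shift: "v - 2 * int n * k = L z \<or> v - 2 * int n * k = L z + 2 * int n"
      using mk m by (auto simp: algebra_simps)
    have "y \<noteq> 0" "z \<noteq> 0" "x \<noteq> 0" "\<bar>x\<bar> \<le> int n" "\<bar>y\<bar> \<le> int n" "\<bar>z\<bar> \<le> int n"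
      using x y z by (auto simp: signed_points_def)
    then show ?thesis
      using bounds shift
      by (cases "y > 0"; cases "z > 0"; auto simp: separates_def L_def sgn_if)
  qed
  finally show ?thesis by simp
qed

lemma mod_eq_window:
  fixes a b s m :: int
  assumes "a mod m = b mod m" "s \<le> a" "a < s + m" "s \<le> b" "b < s + m"
  shows "a = b"
proof -
  have "m dvd a - b" using assms(1) by (simp add: mod_eq_dvd_iff)
  moreover have "\<bar>a - b\<bar> < m" using assms by linarith
  ultimately show ?thesis using dvd_imp_le_int[of "a - b" m] by fastforce
qed

lemma image_eq_image_obtain:
  assumes "f ` A = g ` B" "b \<in> B"
  obtains a where "a \<in> A" "f a = g b"
proof -
  have "g b \<in> f ` A" using assms by simp
  then show thesis by (elim imageE) (rule that, simp_all)
qed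

text \<open>With two integer endpoints in place of start and length, an interval grows on either
  side by moving \<open>s\<close> or \<open>t\<close> by one.\<close>

lemma circle_interval_iff:
  "circle_interval n A \<longleftrightarrow> A \<subseteq> signed_points n \<and>
     (\<exists>s t. s \<le> t \<and> circle_pos n ` A = (\<lambda>u. u mod (2 * int n)) ` {s..<t})"
proof -
  have img: "(\<lambda>i. (s + int i) mod (2 * int n)) ` {..<l} = (\<lambda>u. u mod (2 * int n)) ` {s..<s + int l}"
    for s l
  proof -
    have "{s..<s + int l} = (\<lambda>i. s + int i) ` {..<l}"
    proof (intro equalityI subsetI)
      fix u assume "u \<in> {s..<s + int l}"
      then show "u \<in> (\<lambda>i. s + int i) ` {..<l}"
        by (intro image_eqI[of _ _ "nat (u - s)"]) auto
    qed auto
    then show ?thesis by (simp add: image_image)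
  qed
  have "(\<exists>s l. circle_pos n ` A = (\<lambda>u. u mod (2 * int n)) ` {s..<s + int l}) \<longleftrightarrow>
      (\<exists>s t. s \<le> t \<and> circle_pos n ` A = (\<lambda>u. u mod (2 * int n)) ` {s..<t})"
  proof safe
    fix s l assume "circle_pos n ` A = (\<lambda>u. u mod (2 * int n)) ` {s..<s + int l}"
    then show "\<exists>s t. s \<le> t \<and> circle_pos n ` A = (\<lambda>u. u mod (2 * int n)) ` {s..<t}"
      by (intro exI[of _ s] exI[of _ "s + int l"]) simp
  next
    fix s t :: int assume "s \<le> t" "circle_pos n ` A = (\<lambda>u. u mod (2 * int n)) ` {s..<t}"
    then show "\<exists>s l. circle_pos n ` A = (\<lambda>u. u mod (2 * int n)) ` {s..<s + int l}"
      by (intro exI[of _ s] exI[of _ "nat (t - s)"]) simp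
  qed
  then show ?thesis
    by (simp add: circle_interval_def img)
qed

section \<open>Suffixes of a signed permutation\<close>

context
  fixes n :: nat and \<pi> :: "int \<Rightarrow> int"
  assumes \<pi>: "\<pi> \<in> signed_perms n"
begin

lemma signed_perm_in: "a \<in> signed_points n \<Longrightarrow> \<pi> a \<in> signed_points n"
  using \<pi> permutes_in_image unfolding signed_perms_def by fastforce

lemma signed_perm_in_int: "1 \<le> i \<Longrightarrow> i \<le> int n \<Longrightarrow> \<pi> i \<in> signed_points n"
  by (rule signed_perm_in) (simp add: signed_points_def)

lemma suffix_subset: "1 \<le> j \<Longrightarrow> \<pi> ` {j..int n} \<subseteq> signed_points n"
  using signed_perm_in by (force simp: signed_points_def)

lemma signed_perm_abs_eq:
  assumes "i \<in> {1..int n}" "j \<in> {1..int n}" "\<bar>\<pi> i\<bar> = \<bar>\<pi> j\<bar>"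
  shows "i = j"
proof -
  have sp: "i \<in> signed_points n" "j \<in> signed_points n"
    using assms by (auto simp: signed_points_def)
  have "\<pi> i = \<pi> j \<or> \<pi> i = \<pi> (- j)"
    using assms(3) sp \<pi> by (auto simp: signed_perms_def abs_eq_iff)
  moreover have "inj \<pi>"
    using \<pi> by (auto simp: signed_perms_def permutes_inj)
  ultimately have "i = j \<or> i = - j" by (auto dest: injD)
  then show ?thesis using assms by auto
qed

lemma signed_perm_abs_surj:
  assumes "a \<in> signed_points n"
  obtains i where "i \<in> {1..int n}" "\<bar>\<pi> i\<bar> = \<bar>a\<bar>"
proof -
  have "\<pi> ` signed_points n = signed_points n"
    using \<pi> by (auto simp: signed_perms_def permutes_image)
  then obtain b where b: "b \<in> signed_points n" "a = \<pi> b"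
    using assms by blast
  \<comment> \<open>The preimage \<open>b\<close> may be negative; oddness allows passing to
    \<bar>b\<bar>, a genuine index.\<close>
  have "\<pi> (- b) = - a"
    using b \<pi> by (auto simp: signed_perms_def)
  then have "\<bar>\<pi> \<bar>b\<bar>\<bar> = \<bar>a\<bar>"
    using b by (auto simp: abs_if)
  then show ?thesis
    using b by (intro that[of "\<bar>b\<bar>"]) (auto simp: signed_points_def)
qed

lemma suffix_no_antipodes:
  assumes "1 \<le> j" "a \<in> \<pi> ` {j..int n}"
  shows "- a \<notin> \<pi> ` {j..int n}"
proof
  assume "- a \<in> \<pi> ` {j..int n}"
  then obtain p q where pq: "p \<in> {j..int n}" "q \<in> {j..int n}" "\<pi> p = a" "\<pi> q = - a"
    using assms by force
  then have "p = q" using signed_perm_abs_eq[of p q] assms(1) by auto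
  then have "a = 0" using pq by auto
  then show False using suffix_subset[OF assms(1)] assms(2) by (auto simp: signed_points_def)
qed

text \<open>A longer range would contain both \<open>s\<close> and \<open>s + n\<close>, lifts of
  antipodal points.\<close>

lemma suffix_arc_short:
  assumes j: "1 \<le> j"
    and arc: "circle_pos n ` \<pi> ` {j..int n} = (\<lambda>u. u mod (2 * int n)) ` {s..<t}"
  shows "t \<le> s + int n"
proof (rule ccontr)
  assume "\<not> t \<le> s + int n"
  then have "s \<in> {s..<t}" "s + int n \<in> {s..<t}" by auto
  then obtain a b where ab: "a \<in> \<pi> ` {j..int n}" "b \<in> \<pi> ` {j..int n}"
      "circle_pos n a = s mod (2 * int n)" "circle_pos n b = (s + int n) mod (2 * int n)"
    using image_eq_image_obtain[OF arc] by metis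
  have sp: "a \<in> signed_points n" "b \<in> signed_points n"
    using ab suffix_subset[OF j] by auto
  have "circle_pos n (- a) = circle_pos n b"
    using circle_pos_uminus[OF sp(1)] ab by (simp add: mod_simps)
  moreover have "- a \<in> signed_points n" using sp by (auto simp: signed_points_def)
  ultimately have "- a = b" using inj_on_circle_pos[of n] sp by (auto dest: inj_onD)
  then show False using suffix_no_antipodes[OF j ab(1)] ab by simp
qed

section \<open>Necessity of pattern avoidance\<close>

lemma B_arc_imp_not_separates:
  assumes "B_arc n \<pi>" "1 \<le> i" "i < j" "j < k" "k \<le> int n"
  shows "\<not> separates (\<pi> i) (\<pi> j) (\<pi> k)"
proof
  assume sep: "separates (\<pi> i) (\<pi> j) (\<pi> k)"
  let ?A = "\<pi> ` {j..int n}"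
  have j1: "1 \<le> j" using assms by simp
  have "circle_interval n ?A" using assms by (auto simp: B_arc_def)
  then obtain s t where arc: "circle_pos n ` ?A = (\<lambda>u. u mod (2 * int n)) ` {s..<t}"
    by (auto simp: circle_interval_iff)
  have short: "t \<le> s + int n" using suffix_arc_short[OF j1 arc] .
  have sp: "\<pi> i \<in> signed_points n" "\<pi> j \<in> signed_points n" "\<pi> k \<in> signed_points n"
    using assms by (auto intro!: signed_perm_in_int)
  have "circle_pos n (\<pi> j) \<in> circle_pos n ` ?A" "circle_pos n (\<pi> k) \<in> circle_pos n ` ?A"
    using assms by auto
  then obtain u v where u: "u \<in> {s..<t}" "circle_pos n (\<pi> j) = u mod (2 * int n)"
    and v: "v \<in> {s..<t}" "circle_pos n (\<pi> k) = v mod (2 * int n)"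
    unfolding arc by blast
  have "\<pi> j \<noteq> \<pi> k" using signed_perm_abs_eq[of j k] assms by auto
  then have "u \<noteq> v"
    using u(2) v(2) circle_pos_inject[OF sp(2,3)] by metis
  \<comment> \<open>Both lifts lie in a range of length at most n, hence less than n apart. Either
    may come first, but \<open>separates\<close> is symmetric in its last two arguments.\<close>
  then have "\<exists>w \<in> {s..<t}. w mod int n = \<bar>\<pi> i\<bar> mod int n"
  proof (cases "u < v")
    case True
    then have "\<exists>w>u. w < v \<and> w mod int n = \<bar>\<pi> i\<bar> mod int n"
      using separates_iff_between[OF sp u(2) v(2)] sep u v short by simp
    then show ?thesis using u v by fastforce
  next
    case False
    then have "\<exists>w>v. w < u \<and> w mod int n = \<bar>\<pi> i\<bar> mod int n"
      using separates_iff_between[OF sp(1,3,2) v(2) u(2)] sep \<open>u \<noteq> v\<close> u v short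
      by (simp add: separates_commute)
    then show ?thesis using u v by fastforce
  qed
  \<comment> \<open>The lift \<open>w\<close> belongs to a suffix element equal to \<plusminus>\<pi>
    i, whose index is at least \<open>j\<close> and yet has to be \<open>i\<close>.\<close>
  then obtain w where w: "w \<in> {s..<t}" "w mod int n = \<bar>\<pi> i\<bar> mod int n" by blast
  then obtain a where a: "a \<in> ?A" "circle_pos n a = w mod (2 * int n)"
    using image_eq_image_obtain[OF arc] by metis
  then obtain p where p: "p \<in> {j..int n}" "a = \<pi> p" by blast
  have "\<bar>a\<bar> mod int n = \<bar>\<pi> i\<bar> mod int n"
    using a(2) w(2) circle_pos_mod_n[of n a] by (simp add: mod_mod_cancel)
  then have "\<bar>a\<bar> = \<bar>\<pi> i\<bar>"
    using abs_eq_if_mod_eq sp(1) a(1) suffix_subset[OF j1] by blast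
  then show False
    using signed_perm_abs_eq[of p i] p assms by auto
qed

section \<open>Sufficiency: extending an interval by one point\<close>

text \<open>A point \<pi> j away from both ends of the arc leaves a gap on its shorter way to the
  arc. The gap position next to the arc is occupied, up to sign, by an earlier \<pi> i, which
  separates \<pi> j from the end of the arc.\<close>

lemma arc_extend:
  assumes ns: "\<And>i k. 1 \<le> i \<Longrightarrow> i < j \<Longrightarrow> j < k \<Longrightarrow> k \<le> int n \<Longrightarrow> \<not> separates (\<pi> i) (\<pi> j) (\<pi> k)"
    and j: "1 \<le> j" "j < int n"
    and arc: "circle_pos n ` \<pi> ` {j + 1..int n} = (\<lambda>u. u mod (2 * int n)) ` {s..<t}"
  obtains s' t' where "s' \<le> t'" "circle_pos n ` \<pi> ` {j..int n} = (\<lambda>u. u mod (2 * int n)) ` {s'..<t'}"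
proof -
  let ?A = "\<pi> ` {j + 1..int n}" and ?N = "2 * int n"
  have short: "t \<le> s + int n" using suffix_arc_short[OF _ arc] j by simp
  have st: "s < t"
  proof (rule ccontr)
    assume "\<not> s < t"
    then have "?A = {}" using arc by simp
    then show False using j by simp
  qed
  have sub: "?A \<subseteq> signed_points n" using suffix_subset[of "j + 1"] j by simp
  have jsp: "\<pi> j \<in> signed_points n"
    using j by (auto intro!: signed_perm_in_int)
  have ksp: "\<pi> k \<in> signed_points n" if "j < k" "k \<le> int n" for k
    using that sub by auto
  have memI: "\<exists>k. j < k \<and> k \<le> int n \<and> circle_pos n (\<pi> k) = u mod ?N" if "s \<le> u" "u < t" for u
  proof -
    have "u mod ?N \<in> circle_pos n ` ?A" unfolding arc using that by auto
    then obtain k where "k \<in> {j + 1..int n}" "circle_pos n (\<pi> k) = u mod ?N" by auto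
    then show ?thesis by (intro exI[of _ k]) auto
  qed
  \<comment> \<open>The lift of \<pi> j in the window of one full turn starting at
    \<open>s\<close>.\<close>
  define x where "x = s + (circle_pos n (\<pi> j) - s) mod ?N"
  have x: "circle_pos n (\<pi> j) = x mod ?N" "s \<le> x" "x < s + ?N"
    using j by (auto simp: x_def mod_simps)
  have jA: "\<pi> k \<noteq> \<pi> j \<and> \<pi> k \<noteq> - \<pi> j" if "j < k" "k \<le> int n" for k
    using signed_perm_abs_eq[of j k] that j by auto
  have "t \<le> x"
  proof (rule ccontr)
    assume "\<not> t \<le> x"
    then obtain k where "j < k" "k \<le> int n" "circle_pos n (\<pi> k) = x mod ?N"
      using memI[of x] x by auto
    then show False using circle_pos_inject[OF ksp jsp] jA x by metis
  qed
  moreover have "\<not> (s + int n \<le> x \<and> x < t + int n)"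
  proof
    assume "s + int n \<le> x \<and> x < t + int n"
    then obtain k where k: "j < k" "k \<le> int n" "circle_pos n (\<pi> k) = (x - int n) mod ?N"
      using memI[of "x - int n"] by auto
    have "(x - int n) mod ?N = (x - int n + ?N) mod ?N" by (rule mod_add_self2[symmetric])
    also have "x - int n + ?N = x + int n" by simp
    finally have "circle_pos n (\<pi> k) = circle_pos n (- \<pi> j)"
      using k x circle_pos_uminus[OF jsp] by (simp add: mod_simps)
    then show False using circle_pos_inject[OF ksp uminus_signed_points[OF jsp]] jA k by metis
  qed
  \<comment> \<open>The window minus the arc and its antipodal copy [s + n, t + n) consists of two
    gaps; the end of each that touches the arc, \<open>t\<close> or s + 2n - 1, is split
    off.\<close>
  ultimately consider "x = t" | "t < x" "x < s + int n" | "t + int n \<le> x" "x < s + ?N - 1" | "x = s + ?N - 1"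
    using x st short by linarith
  note cases = this
  have ins: "circle_pos n ` \<pi> ` {j..int n} = insert (x mod ?N) ((\<lambda>u. u mod ?N) ` {s..<t})"
  proof -
    have "{j..int n} = insert j {j + 1..int n}" using j by auto
    then show ?thesis using arc x(1) by simp
  qed
  \<comment> \<open>Up to sign \<open>q\<close> is some \<pi> i. The conditions \<open>w\<close>
    \<noteq> \<open>x\<close> and \<open>w + n\<close> \<noteq> \<open>x\<close> exclude i = j; i >
    j would put \<open>w\<close> or \<open>w + n\<close> inside [s, t). So i < j, and
    \<open>ns\<close> applies.\<close>
  have notsep: "\<not> separates q (\<pi> j) (\<pi> k)"
    if q: "q \<in> signed_points n" "circle_pos n q = w mod ?N"
      and w: "t \<le> w" "w < s + int n" "w \<noteq> x" "w + int n \<noteq> x" and k: "j < k" "k \<le> int n" for q w k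
  proof -
    obtain i where i: "i \<in> {1..int n}" "\<bar>\<pi> i\<bar> = \<bar>q\<bar>"
      using signed_perm_abs_surj[OF q(1)] .
    then have q_cases: "q = \<pi> i \<or> q = - \<pi> i" by auto
    have isp: "\<pi> i \<in> signed_points n"
      using i by (auto intro!: signed_perm_in_int)
    have pos_uminus: "(w + int n) mod ?N = circle_pos n (\<pi> i)" if "q = - \<pi> i"
      using circle_pos_uminus[OF q(1)] q(2) that by (simp add: mod_simps)
    have "i \<noteq> j"
    proof
      assume "i = j"
      then have "w mod ?N = x mod ?N \<or> (w + int n) mod ?N = x mod ?N"
        using q_cases q(2) x(1) pos_uminus by auto
      then have "w = x \<or> w + int n = x"
        using mod_eq_window[of w ?N x s] mod_eq_window[of "w + int n" ?N x s] w x st by auto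
      then show False using w by auto
    qed
    moreover have "\<not> j < i"
    proof
      assume "j < i"
      then have "circle_pos n (\<pi> i) \<in> circle_pos n ` ?A" using i by auto
      then obtain u where u: "s \<le> u" "u < t" "circle_pos n (\<pi> i) = u mod ?N"
        unfolding arc by auto
      then have "w mod ?N = u mod ?N \<or> (w + int n) mod ?N = u mod ?N"
        using q_cases q(2) pos_uminus by auto
      then have "w = u \<or> w + int n = u"
        using mod_eq_window[of w ?N u s] mod_eq_window[of "w + int n" ?N u s] w u st short by auto
      then show False using w u short by auto
    qed
    ultimately have "\<not> separates (\<pi> i) (\<pi> j) (\<pi> k)"
      using ns i k by auto
    then show ?thesis using separates_cong_abs i by metis
  qed
  from cases show ?thesis
  proof cases
    case 1
    have "{s..<t + 1} = insert t {s..<t}" using st by auto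
    then show ?thesis using ins 1 st by (intro that[of s "t + 1"]) auto
  next
    case 2
    \<comment> \<open>The point at \<open>t\<close> lies strictly between the last arc point, at t -
      1, and \<open>x\<close>; as s \<le> t - 1 and x < s + n, this way is the shorter one.\<close>
    obtain q where q: "q \<in> signed_points n" "circle_pos n q = t mod ?N"
      using circle_pos_surj[of n t] j by auto
    obtain k where k: "j < k" "k \<le> int n" "circle_pos n (\<pi> k) = (t - 1) mod ?N"
      using memI[of "t - 1"] st by auto
    have "separates q (\<pi> k) (\<pi> j)"
      using separates_iff_between[OF q(1) ksp[OF k(1,2)] jsp k(3) x(1)] 2 st
        circle_pos_mod_n[of n q] q(2)
      by (auto simp: mod_mod_cancel intro!: exI[of _ t])
    moreover have "\<not> separates q (\<pi> j) (\<pi> k)"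
      by (rule notsep[OF q _ _ _ _ k(1,2)]) (use 2 st in linarith)+
    ultimately show ?thesis
      using separates_commute by blast
  next
    case 3
    \<comment> \<open>The missing neighbour of the arc is at s - 1, equivalently s + 2n - 1.
      \<open>notsep\<close> wants a lift in [t, s + n), so its antipode is used, and the start of
      the arc is lifted to s + 2n.\<close>
    let ?w = "s + int n - 1"
    obtain q where q: "q \<in> signed_points n" "circle_pos n q = ?w mod ?N"
      using circle_pos_surj[of n ?w] j by auto
    obtain k where k: "j < k" "k \<le> int n" "circle_pos n (\<pi> k) = (s + ?N) mod ?N"
      using memI[of s] st by auto
    have "?w mod int n = \<bar>q\<bar> mod int n"
      using circle_pos_mod_n[of n q] q(2) by (simp add: mod_mod_cancel)
    moreover have "(?w + int n) mod int n = ?w mod int n" by (rule mod_add_self2)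
    ultimately have "\<exists>w>x. w < s + ?N \<and> w mod int n = \<bar>q\<bar> mod int n"
      using 3 by (intro exI[of _ "?w + int n"]) auto
    then have "separates q (\<pi> j) (\<pi> k)"
      using separates_iff_between[OF q(1) jsp ksp[OF k(1,2)] x(1) k(3)] 3 st by auto
    moreover have "\<not> separates q (\<pi> j) (\<pi> k)"
      by (rule notsep[OF q _ _ _ _ k(1,2)]) (use 3 st in linarith)+
    ultimately show ?thesis by blast
  next
    case 4
    have "{s - 1..<t} = insert (s - 1) {s..<t}" using st by auto
    \<comment> \<open>One full turn back, \<open>x\<close> is the position just before
      \<open>s\<close>.\<close>
    moreover have "x mod ?N = (s - 1) mod ?N"
      unfolding 4 using mod_add_self2[of "s - 1" ?N] by (simp only: diff_add_eq)
    ultimately show ?thesis using ins st by (intro that[of "s - 1" t]) auto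
  qed
qed

text \<open>Downward induction on \<open>j\<close> from the one-point suffix at n, with
  \<open>arc_extend\<close> as the step.\<close>

lemma not_separates_imp_B_arc:
  assumes ns: "\<And>i j k. 1 \<le> i \<Longrightarrow> i < j \<Longrightarrow> j < k \<Longrightarrow> k \<le> int n \<Longrightarrow> \<not> separates (\<pi> i) (\<pi> j) (\<pi> k)"
  shows "B_arc n \<pi>"
proof -
  have "circle_interval n (\<pi> ` {j..int n})" if "j \<le> int n" "1 \<le> j" for j
    using that
  proof (induction j rule: int_le_induct)
    case base
    define c where "c = circle_pos n (\<pi> (int n))"
    have "{c..<c + 1} = {c}" by auto
    then have "circle_pos n ` \<pi> ` {int n..int n} = (\<lambda>u. u mod (2 * int n)) ` {c..<c + 1}"
      by (simp add: c_def)
    moreover have "c \<le> c + 1" by simp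
    ultimately show ?case
      unfolding circle_interval_iff using suffix_subset[OF base] by blast
  next
    case (step j)
    then obtain s t where "circle_pos n ` \<pi> ` {j..int n} = (\<lambda>u. u mod (2 * int n)) ` {s..<t}"
      by (auto simp: circle_interval_iff)
    then have "circle_pos n ` \<pi> ` {j - 1 + 1..int n} = (\<lambda>u. u mod (2 * int n)) ` {s..<t}"
      by simp
    moreover have "1 \<le> j - 1" "j - 1 < int n" using step by auto
    ultimately obtain s' t' where "s' \<le> t'"
      "circle_pos n ` \<pi> ` {j - 1..int n} = (\<lambda>u. u mod (2 * int n)) ` {s'..<t'}"
      using arc_extend[of "j - 1" s t] ns by metis
    then show ?case
      unfolding circle_interval_iff using suffix_subset step by blast
  qed
  then show ?thesis using \<pi> by (auto simp: B_arc_def)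
qed

end

theorem theorem5p5:
  fixes n :: nat and \<pi> :: "int \<Rightarrow> int"
  assumes "\<pi> \<in> signed_perms n"
  shows "B_arc n \<pi> \<longleftrightarrow> (\<forall>ws \<in> B_arc_windows. avoids_pattern n \<pi> 3 (of_window ws))"
proof -
  have "\<pi> i \<noteq> 0" if "i \<in> {1..int n}" for i
    using that signed_perm_in[OF assms, of i] by (auto simp: signed_points_def)
  then have "(\<exists>ws \<in> B_arc_windows. contains_pattern n \<pi> 3 (of_window ws)) \<longleftrightarrow>
      (\<exists>i j k. 1 \<le> i \<and> i < j \<and> j < k \<and> k \<le> int n \<and> separates (\<pi> i) (\<pi> j) (\<pi> k))"
    by (rule contains_B_arc_window_iff)
  then show ?thesis
    using B_arc_imp_not_separates[OF assms] not_separates_imp_B_arc[OF assms] by blast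
qed

end
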